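(* For every fixed integer $a\geq 2$, the limit \[ \lim_{q\rightarrow\infty}\frac{\chi_{sc}(K_{a,q})-2q}{\sqrt{q}} \] exists.
   Context: $K_{a,q}$ is the complete bipartite graph with parts of sizes $a$ and $q$. For a graph $G=(V,E)$ and $f:V\to\mathbb{N}$, an $f$-assignment is an assignment of color lists $L(v)$ with $|L(v)|=f(v)$; $G$ is $f$-choosable if for every $f$-assignment $L$ there is a proper coloring $c$ with $c(v)\in L(v)$ for all $v$. The sum choice number $\chi_{sc}(G)$ is the minimum of $\sum_{v\in V}f(v)$ over all $f$ such that $G$ is $f$-choosable. *)

theory Defs
  imports Complex_Main "Graph_Theory.Kuratowski"
begin

text \<open>
  As in the underlying library, an undirected simple graph is a symmetric loop-free digraph
  (locale \<open>pair_graph\<close>): an edge \<open>uv\<close> is the pair of arcs \<open>(u, v)\<close> and \<open>(v, u)\<close>.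
\<close>

definition f_assignment :: "'a pair_pre_digraph \<Rightarrow> ('a \<Rightarrow> nat) \<Rightarrow> ('a \<Rightarrow> 'c set) \<Rightarrow> bool" where
  "f_assignment G f L \<longleftrightarrow> (\<forall>v \<in> pverts G. finite (L v) \<and> card (L v) = f v)"

definition proper_coloring :: "'a pair_pre_digraph \<Rightarrow> ('a \<Rightarrow> 'c) \<Rightarrow> bool" where
  "proper_coloring G c \<longleftrightarrow> (\<forall>(u, v) \<in> parcs G. c u \<noteq> c v)"

definition list_colorable :: "'a pair_pre_digraph \<Rightarrow> ('a \<Rightarrow> 'c set) \<Rightarrow> bool" where
  "list_colorable G L \<longleftrightarrow> (\<exists>c. proper_coloring G c \<and> (\<forall>v \<in> pverts G. c v \<in> L v))"

text \<open>
  Colors are natural numbers. On a finite graph this is no restriction: the lists of an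
  assignment use finitely many colors in total (lemma \<open>f_choosable_any_color\<close> below).
\<close>

definition f_choosable :: "'a pair_pre_digraph \<Rightarrow> ('a \<Rightarrow> nat) \<Rightarrow> bool" where
  "f_choosable G f \<longleftrightarrow> (\<forall>L :: 'a \<Rightarrow> nat set. f_assignment G f L \<longrightarrow> list_colorable G L)"

definition sum_choice_number :: "'a pair_pre_digraph \<Rightarrow> nat" where
  "sum_choice_number G = (LEAST n. \<exists>f. f_choosable G f \<and> (\<Sum>v \<in> pverts G. f v) = n)"

definition complete_bipartite :: "nat \<Rightarrow> nat \<Rightarrow> (nat + nat) pair_pre_digraph" where
  "complete_bipartite a q = \<lparr> pverts = {..<a} <+> {..<q},
     parcs = (Inl ` {..<a}) \<times> (Inr ` {..<q}) \<union> (Inr ` {..<q}) \<times> (Inl ` {..<a}) \<rparr>"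

lemma complete_bipartite_digraph_complete_bipartite:
  "complete_bipartite_digraph a q (with_proj (complete_bipartite a q))"
  unfolding complete_bipartite_digraph_pair_def
proof (intro conjI exI)
  show "card (Inl ` {..<a} :: (nat + nat) set) = a"
    and "card (Inr ` {..<q} :: (nat + nat) set) = q"
    by (simp_all add: card_image)
qed (auto simp: complete_bipartite_def)

lemma f_choosable_any_color:
  fixes L :: "'a \<Rightarrow> 'c set"
  assumes "pair_graph G" "f_choosable G f" "f_assignment G f L"
  shows "list_colorable G L"
proof -
  interpret pair_graph G by fact
  let ?C = "\<Union>v \<in> pverts G. L v"
  have "finite ?C"
    using assms(3) pair_finite_verts by (auto simp: f_assignment_def)
  then obtain h :: "'c \<Rightarrow> nat" where h: "inj_on h ?C"
    using finite_imp_inj_to_nat_seg by metis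
  have hv: "inj_on h (L v)" if "v \<in> pverts G" for v
    by (rule inj_on_subset[OF h]) (use that in auto)
  have "f_assignment G f (\<lambda>v. h ` L v)"
    using assms(3) hv by (auto simp: f_assignment_def card_image)
  then obtain c where c: "proper_coloring G c" "\<forall>v \<in> pverts G. c v \<in> h ` L v"
    using assms(2) by (auto simp: f_choosable_def list_colorable_def)
  then obtain d where d: "\<forall>v \<in> pverts G. d v \<in> L v \<and> c v = h (d v)"
    by (auto simp: image_iff Bex_def dest!: bchoice)
  have "proper_coloring G d"
    unfolding proper_coloring_def
  proof clarify
    fix u v assume uv: "(u, v) \<in> parcs G" and eq: "d u = d v"
    have "c u = c v"
      using d in_arcsD1[OF uv] in_arcsD2[OF uv] eq by simp
    with c(1) uv show False by (auto simp: proper_coloring_def)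
  qed
  with d show ?thesis by (auto simp: list_colorable_def)
qed

lemma f_choosable_card_verts:
  assumes "pair_graph G"
  shows "f_choosable G (\<lambda>_. card (pverts G))"
  unfolding f_choosable_def
proof (intro allI impI)
  interpret pair_graph G by fact
  fix L :: "'a \<Rightarrow> nat set"
  assume L: "f_assignment G (\<lambda>_. card (pverts G)) L"
  have "\<exists>c. inj_on c S \<and> (\<forall>v \<in> S. c v \<in> L v)" if "finite S" "S \<subseteq> pverts G" for S
    using that
  proof (induction S rule: finite_induct)
    case (insert x S)
    then obtain c where c: "inj_on c S" "\<forall>v \<in> S. c v \<in> L v" by auto
    have "card (c ` S) < card (insert x S)"
      using insert.hyps card_image_le[of S c] by simp
    also have "\<dots> \<le> card (L x)"
      using L insert.prems card_mono[OF pair_finite_verts insert.prems]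
      by (simp add: f_assignment_def)
    finally have "\<not> L x \<subseteq> c ` S"
      using card_mono[of "c ` S" "L x"] insert.hyps(1) by auto
    then obtain y where "y \<in> L x" "y \<notin> c ` S" by auto
    with c insert.hyps have "inj_on (c(x := y)) (insert x S)"
      "\<forall>v \<in> insert x S. (c(x := y)) v \<in> L v"
      by (auto simp: inj_on_def)
    then show ?case by blast
  qed auto
  from this[OF pair_finite_verts subset_refl]
  obtain c where c: "inj_on c (pverts G)" "\<forall>v \<in> pverts G. c v \<in> L v" by auto
  have "proper_coloring G c"
    unfolding proper_coloring_def
  proof clarify
    fix u v assume uv: "(u, v) \<in> parcs G" and eq: "c u = c v"
    have "u = v"
      using inj_onD[OF c(1) eq in_arcsD1[OF uv] in_arcsD2[OF uv]] .
    with pair_no_loops[OF uv] show False by simp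
  qed
  with c(2) show "list_colorable G L" by (auto simp: list_colorable_def)
qed

lemma sum_choice_number_attained:
  assumes "pair_graph G"
  shows "\<exists>f. f_choosable G f \<and> (\<Sum>v \<in> pverts G. f v) = sum_choice_number G"
proof -
  have "\<exists>n f. f_choosable G f \<and> (\<Sum>v \<in> pverts G. f v) = n"
    using f_choosable_card_verts[OF assms] by blast
  then show ?thesis
    unfolding sum_choice_number_def by (rule LeastI_ex)
qed

end

theory Submission
  imports Defs
begin

text \<open>
  Let \<open>F(q)\<close> be the least total list size on the \<open>a\<close>-side that suffices when all \<open>q\<close> vertices of the
  other side have lists of size 2. Such lists are \<open>q\<close> pairs of colors that a choice of colors on the
  \<open>a\<close>-side must not contain. Replacing each color by \<open>t\<close> copies gives \<open>F(q) \<le> F(t\<^sup>2 q) / t + a\<close>, and a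
  greedy choice gives \<open>F(q) = O(\<surd>q)\<close>; with monotonicity, \<open>F(q) / \<surd>q\<close> converges to the supremum of
  \<open>(F(q) - a) / \<surd>q\<close>.

  Clearly \<open>\<chi>\<^sub>s\<^sub>c - 2q \<le> F(q)\<close>. Conversely, in an optimal size function let \<open>r\<close> lists on the \<open>q\<close>-side
  have size 1 and \<open>p\<close> have size 2. The singletons can block \<open>r\<close> colors of any one vertex on the
  \<open>a\<close>-side, so every list there is larger than \<open>r\<close>, and lowering one of them by \<open>r\<close> yields sizes that
  still suffice against \<open>p\<close> pairs. Hence \<open>F(p) \<le> \<chi>\<^sub>s\<^sub>c - 2q\<close> and \<open>q - p \<le> \<chi>\<^sub>s\<^sub>c - 2q = O(\<surd>q)\<close>, and the
  two bounds have the same limit after division by \<open>\<surd>q\<close>.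
\<close>

section \<open>Choices of colors that avoid forbidden pairs\<close>

text \<open>A list of two colors becomes one ordered pair in \<open>R\<close>, in either
  orientation, since \<open>i\<close> and \<open>j\<close> range over all ordered pairs;
  \<open>irrefl R\<close> says that its colors differ. The bound is \<open>card R \<le> m\<close>
  because several vertices may carry the same list.\<close>

definition forcing :: "nat \<Rightarrow> (nat \<Rightarrow> nat) \<Rightarrow> nat \<Rightarrow> bool" where
  "forcing a f m \<longleftrightarrow> (\<forall>(A :: nat \<Rightarrow> nat set) R.
     (\<forall>i<a. finite (A i) \<and> card (A i) = f i) \<longrightarrow> finite R \<longrightarrow> card R \<le> m \<longrightarrow> irrefl R \<longrightarrow>
     (\<exists>c. (\<forall>i<a. c i \<in> A i) \<and> (\<forall>i<a. \<forall>j<a. (c i, c j) \<notin> R)))"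

lemma forcingI:
  assumes "\<And>(A :: nat \<Rightarrow> nat set) R. (\<And>i. i < a \<Longrightarrow> finite (A i)) \<Longrightarrow> (\<And>i. i < a \<Longrightarrow> card (A i) = f i) \<Longrightarrow>
     finite R \<Longrightarrow> card R \<le> m \<Longrightarrow> irrefl R \<Longrightarrow>
     \<exists>c. (\<forall>i<a. c i \<in> A i) \<and> (\<forall>i<a. \<forall>j<a. (c i, c j) \<notin> R)"
  shows "forcing a f m"
  unfolding forcing_def by (intro allI impI assms) auto

lemma forcingE:
  fixes A :: "nat \<Rightarrow> nat set"
  assumes "forcing a f m" "\<And>i. i < a \<Longrightarrow> finite (A i)" "\<And>i. i < a \<Longrightarrow> card (A i) = f i"
    "finite R" "card R \<le> m" "irrefl R"
  obtains c where "\<And>i. i < a \<Longrightarrow> c i \<in> A i" "\<And>i j. i < a \<Longrightarrow> j < a \<Longrightarrow> (c i, c j) \<notin> R"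
proof -
  have "\<exists>c. (\<forall>i<a. c i \<in> A i) \<and> (\<forall>i<a. \<forall>j<a. (c i, c j) \<notin> R)"
    by (rule assms(1)[unfolded forcing_def, rule_format]) (use assms in auto)
  with that show ?thesis by blast
qed

lemma forcing_mono:
  assumes F: "forcing a f m" and f: "\<And>i. i < a \<Longrightarrow> f i \<le> f' i" and m: "m' \<le> m"
  shows "forcing a f' m'"
proof (rule forcingI)
  fix A :: "nat \<Rightarrow> nat set" and R :: "(nat \<times> nat) set"
  assume A: "\<And>i. i < a \<Longrightarrow> finite (A i)" "\<And>i. i < a \<Longrightarrow> card (A i) = f' i"
    and R: "finite R" "card R \<le> m'" "irrefl R"
  have "\<forall>i. \<exists>B. i < a \<longrightarrow> B \<subseteq> A i \<and> finite B \<and> card B = f i"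
    by (metis A f obtain_subset_with_card_n)
  then obtain B where B: "\<And>i. i < a \<Longrightarrow> B i \<subseteq> A i \<and> finite (B i) \<and> card (B i) = f i"
    by metis
  obtain c where "\<And>i. i < a \<Longrightarrow> c i \<in> B i" "\<And>i j. i < a \<Longrightarrow> j < a \<Longrightarrow> (c i, c j) \<notin> R"
    by (rule forcingE[OF F, of B R]) (use B R m in auto)
  with B show "\<exists>c. (\<forall>i<a. c i \<in> A i) \<and> (\<forall>i<a. \<forall>j<a. (c i, c j) \<notin> R)"
    by blast
qed

text \<open>Every color is replaced by \<open>t\<close> copies, hence every forbidden pair by \<open>t\<^sup>2\<close> pairs.\<close>

lemma forcing_scale:
  assumes F: "forcing a (\<lambda>i. t * f i) (t ^ 2 * m)" and t: "t > 0"
  shows "forcing a f m"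
proof (rule forcingI)
  fix A :: "nat \<Rightarrow> nat set" and R :: "(nat \<times> nat) set"
  assume A: "\<And>i. i < a \<Longrightarrow> finite (A i)" "\<And>i. i < a \<Longrightarrow> card (A i) = f i"
    and R: "finite R" "card R \<le> m" "irrefl R"
  \<comment> \<open>\<open>h (u, r)\<close> is copy \<open>r\<close> of color \<open>u\<close>;
    \<open>div t\<close> recovers the color and \<open>mod t\<close> the copy.\<close>
  define h where "h = (\<lambda>(u, r). u * t + r)"
  define B where "B i = h ` (A i \<times> {..<t})" for i
  define T where "T = (\<lambda>((u, v), (r, s)). (h (u, r), h (v, s))) ` (R \<times> ({..<t} \<times> {..<t}))"
  have h: "h (u, r) div t = u" "h (u, r) mod t = r" if "r < t" for u r
    using that by (simp_all add: h_def)
  have inj: "inj_on h (S \<times> {..<t})" for S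
    by (rule inj_onI) (clarsimp, metis h)
  have "card T \<le> card (R \<times> ({..<t} \<times> {..<t}))"
    unfolding T_def by (rule card_image_le) (use R in auto)
  also have "\<dots> \<le> t ^ 2 * m"
    using R by (simp add: card_cartesian_product power2_eq_square)
  finally have T: "card T \<le> t ^ 2 * m" .
  obtain c where c: "\<And>i. i < a \<Longrightarrow> c i \<in> B i" "\<And>i j. i < a \<Longrightarrow> j < a \<Longrightarrow> (c i, c j) \<notin> T"
  proof (rule forcingE[OF F, of B T])
    show "card (B i) = t * f i" if "i < a" for i
      using that A by (simp add: B_def card_image inj card_cartesian_product)
    show "irrefl T"
      using R(3) unfolding irrefl_def T_def by (auto, metis h(1))
  qed (use A R T in \<open>auto simp: B_def T_def\<close>)
  have mem: "c i div t \<in> A i" and rep: "c i = h (c i div t, c i mod t)" if "i < a" for i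
    using c(1)[OF that] h by (auto simp: B_def)
  have "(c i div t, c j div t) \<notin> R" if "i < a" "j < a" for i j
  proof
    assume *: "(c i div t, c j div t) \<in> R"
    \<comment> \<open>\<open>T\<close> contains every pair of copies of a forbidden pair, hence also
      the two copies chosen by \<open>c\<close>.\<close>
    have "(h (c i div t, c i mod t), h (c j div t, c j mod t)) \<in> T"
      unfolding T_def using * t by (force intro!: image_eqI)
    with c(2)[OF that] rep that show False by simp
  qed
  with mem show "\<exists>c. (\<forall>i<a. c i \<in> A i) \<and> (\<forall>i<a. \<forall>j<a. (c i, c j) \<notin> R)"
    by (intro exI[of _ "\<lambda>i. c i div t"]) auto
qed

section \<open>Greedy choice\<close>

text \<open>Double counting of \<open>R\<close> by first components; the converse relation gives the
  same for second components.\<close>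

lemma card_large_degree:
  assumes "finite R" "d > 0"
  shows "finite {u. d \<le> card (R `` {u})}" "d * card {u. d \<le> card (R `` {u})} \<le> card R"
proof -
  let ?U = "{u. d \<le> card (R `` {u})}"
  have "?U \<subseteq> Domain R"
  proof
    fix u assume "u \<in> ?U"
    with assms(2) have "R `` {u} \<noteq> {}" by (metis card.empty mem_Collect_eq not_le)
    then show "u \<in> Domain R" by auto
  qed
  then show fin: "finite ?U"
    using assms(1) finite_Domain finite_subset by blast
  have finR: "finite (R `` {u})" for u
    using assms(1) by (simp add: finite_Image)
  have "d * card ?U = (\<Sum>u\<in>?U. d)" by simp
  also have "\<dots> \<le> (\<Sum>u\<in>?U. card (R `` {u}))"
    by (rule sum_mono) auto
  also have "\<dots> = card (Sigma ?U (\<lambda>u. R `` {u}))"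
    using fin finR by simp
  also have "\<dots> \<le> card R"
    by (rule card_mono) (use assms in auto)
  finally show "d * card ?U \<le> card R" .
qed

text \<open>Colors in at least \<open>s\<close> forbidden pairs are avoided; the others can be chosen greedily.\<close>

lemma forcing_const:
  assumes s: "s > 0" and m: "m \<le> s * s"
  shows "forcing a (\<lambda>_. 2 * s * (a + 1) + 1) m"
proof (rule forcingI)
  fix A :: "nat \<Rightarrow> nat set" and R :: "(nat \<times> nat) set"
  assume A: "\<And>i. i < a \<Longrightarrow> finite (A i)" "\<And>i. i < a \<Longrightarrow> card (A i) = 2 * s * (a + 1) + 1"
    and R: "finite R" "card R \<le> m" "irrefl R"
  define U where "U = {u. s \<le> card (R `` {u})} \<union> {u. s \<le> card (R\<inverse> `` {u})}"
  have fin: "finite U" and U: "card U \<le> 2 * s"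
  proof -
    note 1 = card_large_degree[OF R(1) s]
    note 2 = card_large_degree[of "R\<inverse>", OF _ s]
    show "finite U" using 1 2 R by (simp add: U_def)
    have "s * card {u. s \<le> card (R `` {u})} \<le> s * s" "s * card {u. s \<le> card (R\<inverse> `` {u})} \<le> s * s"
      using 1(2) 2(2) R(1,2) m by (metis card_inverse finite_converse le_trans)+
    then have "card {u. s \<le> card (R `` {u})} \<le> s" "card {u. s \<le> card (R\<inverse> `` {u})} \<le> s"
      using s by simp_all
    then show "card U \<le> 2 * s"
      unfolding U_def by (intro order_trans[OF card_Un_le]) linarith
  qed
  \<comment> \<open>A color outside \<open>U\<close> excludes fewer than \<open>2 * s\<close> colors
    for later vertices. So \<open>U\<close> and at most \<open>a\<close> earlier choices rule out at
    most \<open>2 * s * (a + 1)\<close> colors, and the \<open>+ 1\<close> in the list size leaves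
    one free.\<close>
  have "\<exists>c. (\<forall>i<k. c i \<in> A i - U) \<and> (\<forall>i<k. \<forall>j<k. (c i, c j) \<notin> R)" if "k \<le> a" for k
    using that
  proof (induction k)
    case (Suc k)
    then obtain c where c: "\<And>i. i < k \<Longrightarrow> c i \<in> A i - U" "\<And>i j. i < k \<Longrightarrow> j < k \<Longrightarrow> (c i, c j) \<notin> R"
      by auto
    define X where "X = (\<Union>i<k. R `` {c i} \<union> R\<inverse> `` {c i})"
    have finX: "finite X"
      using R(1) by (auto simp: X_def finite_Image)
    have "card X \<le> (\<Sum>i<k. card (R `` {c i} \<union> R\<inverse> `` {c i}))"
      unfolding X_def by (rule card_UN_le) simp
    also have "\<dots> \<le> (\<Sum>i<k. 2 * s)"
    proof (rule sum_mono)
      fix i assume "i \<in> {..<k}"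
      then have "card (R `` {c i}) \<le> s" "card (R\<inverse> `` {c i}) \<le> s"
        using c(1)[of i] by (auto simp: U_def)
      then show "card (R `` {c i} \<union> R\<inverse> `` {c i}) \<le> 2 * s"
        using card_Un_le[of "R `` {c i}" "R\<inverse> `` {c i}"] by linarith
    qed
    also have "\<dots> \<le> 2 * s * a"
      using Suc.prems by simp
    finally have "card (U \<union> X) \<le> 2 * s + 2 * s * a"
      using U card_Un_le[of U X] by linarith
    also have "\<dots> < card (A k)"
      using A(2)[of k] Suc.prems by simp
    finally have "\<not> A k \<subseteq> U \<union> X"
      using card_mono[of "U \<union> X" "A k"] fin finX by auto
    then obtain y where y: "y \<in> A k" "y \<notin> U" "y \<notin> X" by auto
    have "(c i, y) \<notin> R" "(y, c i) \<notin> R" if "i < k" for i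
      using y(3) that by (auto simp: X_def)
    then show ?case
      using c y R(3) by (intro exI[of _ "c(k := y)"]) (auto simp: less_Suc_eq irrefl_def)
  qed simp
  from this[of a] show "\<exists>c. (\<forall>i<a. c i \<in> A i) \<and> (\<forall>i<a. \<forall>j<a. (c i, c j) \<notin> R)"
    by auto
qed

section \<open>The least total size and its growth\<close>

text \<open>This is the function \<open>F\<close> of the overview.\<close>

definition forcing_number :: "nat \<Rightarrow> nat \<Rightarrow> nat" where
  "forcing_number a m = (LEAST n. \<exists>f. forcing a f m \<and> (\<Sum>i<a. f i) = n)"

lemma forcing_number_le:
  "forcing a f m \<Longrightarrow> forcing_number a m \<le> (\<Sum>i<a. f i)"
  unfolding forcing_number_def by (rule Least_le) blast

lemma forcing_number_attained:
  obtains f where "forcing a f m" "(\<Sum>i<a. f i) = forcing_number a m"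
proof -
  \<comment> \<open>Taking \<open>Suc m\<close> for \<open>s\<close> is crude but also positive for
    \<open>m = 0\<close>.\<close>
  have "\<exists>n f. forcing a f m \<and> (\<Sum>i<a. f i) = n"
    using forcing_const[of "Suc m" m a] by auto
  then have "\<exists>f. forcing a f m \<and> (\<Sum>i<a. f i) = forcing_number a m"
    unfolding forcing_number_def by (rule LeastI_ex)
  with that show ?thesis by blast
qed

lemma forcing_number_mono: "m \<le> n \<Longrightarrow> forcing_number a m \<le> forcing_number a n"
proof -
  assume "m \<le> n"
  obtain f where "forcing a f n" "(\<Sum>i<a. f i) = forcing_number a n"
    by (rule forcing_number_attained)
  with forcing_mono[OF this(1) order_refl \<open>m \<le> n\<close>] show ?thesis
    using forcing_number_le by metis
qed

text \<open>An optimal \<open>f\<close> for \<open>t ^ 2 * m\<close> is replaced by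
  \<open>f i div t + 1\<close>. Multiplied by \<open>t\<close> this is at least \<open>f i\<close>,
  so \<open>forcing_scale\<close> applies; the \<open>+ 1\<close> at each vertex adds up to
  \<open>a\<close>.\<close>

lemma forcing_number_scale:
  assumes t: "t > 0"
  shows "forcing_number a m \<le> forcing_number a (t ^ 2 * m) / t + a"
proof -
  obtain f where f: "forcing a f (t ^ 2 * m)" "(\<Sum>i<a. f i) = forcing_number a (t ^ 2 * m)"
    by (rule forcing_number_attained)
  have "f i \<le> t * (f i div t + 1)" for i
    using t by (metis add.commute dividend_less_times_div less_imp_le mult.commute mult_Suc_right plus_1_eq_Suc)
  then have "forcing a (\<lambda>i. f i div t + 1) m"
    by (intro forcing_scale[OF forcing_mono[OF f(1)] t]) auto
  then have "real (forcing_number a m) \<le> real (\<Sum>i<a. f i div t + 1)"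
    using forcing_number_le of_nat_le_iff by blast
  also have "\<dots> \<le> (\<Sum>i<a. real (f i) / t + 1)"
    unfolding of_nat_sum by (rule sum_mono) (simp add: of_nat_div_le_of_nat)
  also have "\<dots> = forcing_number a (t ^ 2 * m) / t + a"
    by (simp add: sum.distrib flip: f(2) sum_divide_distrib)
  finally show ?thesis .
qed

text \<open>The greedy bound with \<open>s\<close> the ceiling of \<open>sqrt m\<close>. The factor
  4 comes from \<open>s \<le> 2 * sqrt m\<close>, and the summand 1 is absorbed by
  \<open>1 \<le> sqrt m\<close>.\<close>

lemma forcing_number_le_sqrt:
  assumes "m > 0"
  shows "real (forcing_number a m) \<le> a * (4 * (a + 1) + 1) * sqrt m"
proof -
  define s where "s = nat \<lceil>sqrt m\<rceil>"
  have s1: "real s \<ge> sqrt m" "real s \<le> sqrt m + 1"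
    unfolding s_def using real_sqrt_ge_zero[of m] by linarith+
  have sq: "sqrt m \<ge> 1" using assms by simp
  have "real m = sqrt m * sqrt m" by simp
  also have "\<dots> \<le> real s * real s"
    by (rule mult_mono) (use s1 in auto)
  finally have "m \<le> s * s" by (metis of_nat_le_iff of_nat_mult)
  moreover have "s > 0" using s1 sq by (cases s) auto
  ultimately have "forcing_number a m \<le> (\<Sum>i<a. 2 * s * (a + 1) + 1)"
    using forcing_number_le forcing_const by blast
  then have "real (forcing_number a m) \<le> real (a * (2 * s * (a + 1) + 1))"
    by (metis of_nat_le_iff sum_constant card_lessThan of_nat_id)
  also have "\<dots> = a * (2 * (a + 1) * real s + 1)"
    by (simp add: algebra_simps)
  also have "\<dots> \<le> a * (2 * (a + 1) * (2 * sqrt m) + sqrt m)"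
    by (intro mult_left_mono add_mono) (use s1 sq in \<open>linarith | simp\<close>)+
  finally show ?thesis by (simp add: algebra_simps)
qed

section \<open>A Fekete-type limit from scaling\<close>

text \<open>The limit is the supremum \<open>l\<close> of \<open>v\<close>. Scaling carries each
  value \<open>v p\<close> to all large \<open>q\<close> up to a factor tending to 1, while
  \<open>F q / sqrt q\<close> exceeds \<open>v q\<close> only by \<open>b / sqrt q\<close>.\<close>

lemma sqrt_quotient_limit:
  fixes F :: "nat \<Rightarrow> nat" and b C :: real
  assumes mono: "\<And>m n. m \<le> n \<Longrightarrow> F m \<le> F n"
    and scale: "\<And>t m. t > 0 \<Longrightarrow> F m \<le> F (t ^ 2 * m) / t + b"
    and bound: "\<And>m. m > 0 \<Longrightarrow> F m \<le> C * sqrt m" and b: "b \<ge> 0"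
  shows "\<exists>l. (\<lambda>q. F q / sqrt q) \<longlonglongrightarrow> l"
proof -
  define v where "v q = (F q - b) / sqrt q" for q :: nat
  define l where "l = (SUP q\<in>{0<..}. v q)"
  have "v q \<le> C" if "q > 0" for q
    using bound[OF that] b that by (simp add: v_def field_simps)
  then have bdd: "bdd_above (v ` {0<..})" by (auto intro!: bdd_aboveI)
  have vl: "v q \<le> l" if "q > 0" for q
    unfolding l_def by (rule cSUP_upper) (use bdd that in auto)
  have sqrt_inf: "filterlim (\<lambda>q. sqrt (real q)) at_top sequentially"
    by (intro filterlim_compose[OF sqrt_at_top] filterlim_real_sequentially)
  have "(\<lambda>q. F q / sqrt q) \<longlonglongrightarrow> l"
  proof (rule order_tendstoI)
    fix y assume "y < l"
    then obtain p where p: "p > 0" "y < v p"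
      unfolding l_def by (subst (asm) less_cSUP_iff) (use bdd in auto)
    \<comment> \<open>The floor is the largest \<open>t\<close> with
      \<open>t ^ 2 * p \<le> q\<close>; \<open>scale\<close> leads from \<open>p\<close> to
      \<open>t ^ 2 * p\<close>, and \<open>mono\<close> from there to \<open>q\<close>.\<close>
    have lower: "v p * (real (nat \<lfloor>sqrt q / sqrt p\<rfloor>) * sqrt p / sqrt q) \<le> F q / sqrt q"
      if q: "q \<ge> p" for q
    proof -
      define t where "t = nat \<lfloor>sqrt q / sqrt p\<rfloor>"
      have r: "sqrt q / sqrt p \<ge> 1" using p q by simp
      then have t: "t > 0" "real t \<le> sqrt q / sqrt p" unfolding t_def by linarith+
      have "real t ^ 2 \<le> (sqrt q / sqrt p) ^ 2" by (rule power_mono) (use t in auto)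
      then have "real (t ^ 2 * p) \<le> real q" using p by (simp add: power_divide field_simps)
      then have tq: "t ^ 2 * p \<le> q" by (metis of_nat_le_iff)
      have "F p - b \<le> F (t ^ 2 * p) / t" using scale[OF t(1), of p] by simp
      also have "\<dots> \<le> F q / t" using mono[OF tq] by (intro divide_right_mono) auto
      finally have "(F p - b) * t \<le> F q" using t(1) by (simp add: field_simps)
      then show ?thesis
        unfolding t_def[symmetric] v_def using p q by (simp add: divide_right_mono)
    qed
    \<comment> \<open>The floor loses at most 1, so the factor is at least
      \<open>1 - sqrt p / sqrt q\<close>.\<close>
    have "(\<lambda>q. real (nat \<lfloor>sqrt (real q) / sqrt p\<rfloor>) * sqrt p / sqrt q) \<longlonglongrightarrow> 1"
    proof (rule tendsto_sandwich)
      show "\<forall>\<^sub>F q in sequentially. 1 - sqrt p / sqrt (real q)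
          \<le> real (nat \<lfloor>sqrt (real q) / sqrt p\<rfloor>) * sqrt p / sqrt q"
        using eventually_gt_at_top[of 0]
      proof eventually_elim
        case (elim q)
        have "sqrt q / sqrt p - 1 \<le> real (nat \<lfloor>sqrt (real q) / sqrt p\<rfloor>)" by linarith
        from mult_right_mono[OF this, of "sqrt p / sqrt q"] show ?case
          using elim p by (simp add: left_diff_distrib diff_divide_distrib)
      qed
      show "\<forall>\<^sub>F q in sequentially. real (nat \<lfloor>sqrt (real q) / sqrt p\<rfloor>) * sqrt p / sqrt q \<le> 1"
        using eventually_gt_at_top[of 0]
      proof eventually_elim
        case (elim q)
        have "0 \<le> sqrt (real q) / sqrt p" by simp
        then have "real (nat \<lfloor>sqrt (real q) / sqrt p\<rfloor>) \<le> sqrt q / sqrt p" by linarith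
        from mult_right_mono[OF this, of "sqrt p / sqrt q"] show ?case
          using elim p by simp
      qed
      have "(\<lambda>q. sqrt p / sqrt (real q)) \<longlonglongrightarrow> 0"
        using sqrt_inf by (rule real_tendsto_divide_at_top[OF tendsto_const])
      from tendsto_diff[OF tendsto_const this]
      show "(\<lambda>q. 1 - sqrt p / sqrt (real q)) \<longlonglongrightarrow> 1" by simp
    qed simp
    from tendsto_mult_left[OF this, of "v p"]
    have "(\<lambda>q. v p * (real (nat \<lfloor>sqrt (real q) / sqrt p\<rfloor>) * sqrt p / sqrt q)) \<longlonglongrightarrow> v p" by simp
    from order_tendstoD(1)[OF this p(2)] eventually_ge_at_top[of p]
    show "\<forall>\<^sub>F q in sequentially. y < F q / sqrt q"
      by eventually_elim (use lower in fastforce)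
  next
    fix y assume y: "l < y"
    have "(\<lambda>q. b / sqrt (real q)) \<longlonglongrightarrow> 0"
      using sqrt_inf by (rule real_tendsto_divide_at_top[OF tendsto_const])
    then have "\<forall>\<^sub>F q in sequentially. b / sqrt (real q) < y - l"
      by (rule order_tendstoD) (use y in simp)
    with eventually_gt_at_top[of 0] show "\<forall>\<^sub>F q in sequentially. F q / sqrt q < y"
    proof eventually_elim
      case (elim q)
      with vl[of q] show ?case by (simp add: v_def diff_divide_distrib)
    qed
  qed
  then show ?thesis by blast
qed

section \<open>From list colorings to forbidden pairs and back\<close>

lemma list_colorable_complete_bipartite:
  "list_colorable (complete_bipartite a q) L \<longleftrightarrow>
    (\<exists>c. (\<forall>i<a. c i \<in> L (Inl i)) \<and> (\<forall>j<q. \<not> L (Inr j) \<subseteq> c ` {..<a}))"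
    (is "?l \<longleftrightarrow> ?r")
proof
  assume ?l
  then obtain c where c: "proper_coloring (complete_bipartite a q) c"
    "\<forall>v \<in> pverts (complete_bipartite a q). c v \<in> L v" by (auto simp: list_colorable_def)
  have "c (Inr j) \<in> L (Inr j) - (\<lambda>i. c (Inl i)) ` {..<a}" if "j < q" for j
    using c that by (fastforce simp: proper_coloring_def complete_bipartite_def)
  then show ?r
    using c(2) by (intro exI[of _ "\<lambda>i. c (Inl i)"] conjI) (auto simp: complete_bipartite_def, blast)
next
  assume ?r
  then obtain c where c: "\<forall>i<a. c i \<in> L (Inl i)" "\<forall>j<q. \<exists>x. x \<in> L (Inr j) \<and> x \<notin> c ` {..<a}"
    by blast
  then obtain d where d: "\<forall>j<q. d j \<in> L (Inr j) \<and> d j \<notin> c ` {..<a}"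
    by metis
  have "proper_coloring (complete_bipartite a q) (case_sum c d)"
    using d by (auto simp: proper_coloring_def complete_bipartite_def image_iff) (metis lessThan_iff)+
  moreover have "\<forall>v \<in> pverts (complete_bipartite a q). case_sum c d v \<in> L v"
    using c d by (auto simp: complete_bipartite_def)
  ultimately show ?l unfolding list_colorable_def by blast
qed

lemma f_assignment_complete_bipartite:
  "f_assignment (complete_bipartite a q) f L \<longleftrightarrow>
    (\<forall>i<a. finite (L (Inl i)) \<and> card (L (Inl i)) = f (Inl i)) \<and>
    (\<forall>j<q. finite (L (Inr j)) \<and> card (L (Inr j)) = f (Inr j))"
  by (auto simp: f_assignment_def complete_bipartite_def)

lemma sum_complete_bipartite:
  "(\<Sum>v\<in>pverts (complete_bipartite a q). f v) = (\<Sum>i<a. f (Inl i)) + (\<Sum>j<q. f (Inr j))"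
  by (simp add: complete_bipartite_def sum.Plus)

lemma f_choosable_if_forcing:
  assumes "forcing a f q"
  shows "f_choosable (complete_bipartite a q) (case_sum f (\<lambda>_. 2))"
  unfolding f_choosable_def
proof (intro allI impI)
  fix L :: "nat + nat \<Rightarrow> nat set"
  assume "f_assignment (complete_bipartite a q) (case_sum f (\<lambda>_. 2)) L"
  then have L: "\<And>i. i < a \<Longrightarrow> finite (L (Inl i))" "\<And>i. i < a \<Longrightarrow> card (L (Inl i)) = f i"
    "\<And>j. j < q \<Longrightarrow> card (L (Inr j)) = 2"
    by (auto simp: f_assignment_complete_bipartite)
  have "\<forall>j. \<exists>u v. j < q \<longrightarrow> L (Inr j) = {u, v} \<and> u \<noteq> v"
    using L(3) by (metis card_2_iff)
  then obtain u v where uv: "\<And>j. j < q \<Longrightarrow> L (Inr j) = {u j, v j} \<and> u j \<noteq> v j"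
    by metis
  define R where "R = (\<lambda>j. (u j, v j)) ` {..<q}"
  have R: "card R \<le> q" unfolding R_def by (metis card_image_le card_lessThan finite_lessThan)
  obtain c where c: "\<And>i. i < a \<Longrightarrow> c i \<in> L (Inl i)"
      "\<And>i j. i < a \<Longrightarrow> j < a \<Longrightarrow> (c i, c j) \<notin> R"
    by (rule forcingE[OF assms, of "\<lambda>i. L (Inl i)" R])
      (use L uv R in \<open>auto simp: R_def irrefl_def\<close>)
  have "\<not> L (Inr j) \<subseteq> c ` {..<a}" if "j < q" for j
  proof
    assume "L (Inr j) \<subseteq> c ` {..<a}"
    with uv[OF that] obtain i k where "i < a" "k < a" "c i = u j" "c k = v j" by auto
    with c(2)[of i k] that show False by (auto simp: R_def)
  qed
  with c(1) show "list_colorable (complete_bipartite a q) L"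
    unfolding list_colorable_complete_bipartite by blast
qed

lemma sum_choice_number_le:
  "sum_choice_number (complete_bipartite a q) \<le> forcing_number a q + 2 * q"
proof -
  obtain f where f: "forcing a f q" "(\<Sum>i<a. f i) = forcing_number a q"
    by (rule forcing_number_attained)
  have "(\<Sum>v\<in>pverts (complete_bipartite a q). case_sum f (\<lambda>_. 2) v) = forcing_number a q + 2 * q"
    using f(2) by (simp add: sum_complete_bipartite)
  with f_choosable_if_forcing[OF f(1)] show ?thesis
    unfolding sum_choice_number_def by (intro Least_le) blast
qed

text \<open>This leaves sizes 1, 2 and at least 3 on the \<open>q\<close>-side for the counting
  below.\<close>

lemma f_choosable_pos:
  assumes "f_choosable (complete_bipartite a q) f" "j < q"
  shows "f (Inr j) > 0"
proof -
  have "f_assignment (complete_bipartite a q) f (\<lambda>v. {..<f v})"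
    by (simp add: f_assignment_def)
  then have "list_colorable (complete_bipartite a q) (\<lambda>v. {..<f v})"
    using assms(1) by (auto simp: f_choosable_def)
  with assms(2) show ?thesis
    by (auto simp: list_colorable_complete_bipartite)
qed

text \<open>
  The singleton lists on the \<open>q\<close>-side are spent on blocking fresh colors in the list of vertex \<open>k\<close>.
  Truncated subtraction is intended: if \<open>f (Inl k) \<le> card J1\<close>, the conclusion is absurd by
  \<open>forcing_imp_pos\<close> below.
\<close>

lemma forcing_if_f_choosable:
  assumes ch: "f_choosable (complete_bipartite a q) f"
    and J1: "J1 = {j. j < q \<and> f (Inr j) = 1}" and J2: "J2 = {j. j < q \<and> f (Inr j) = 2}"
  shows "forcing a ((\<lambda>i. f (Inl i))(k := f (Inl k) - card J1)) (card J2)"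
proof (rule forcingI)
  let ?f = "(\<lambda>i. f (Inl i))(k := f (Inl k) - card J1)"
  fix A :: "nat \<Rightarrow> nat set" and R :: "(nat \<times> nat) set"
  assume A: "\<And>i. i < a \<Longrightarrow> finite (A i)" "\<And>i. i < a \<Longrightarrow> card (A i) = ?f i"
    and R: "finite R" "card R \<le> card J2" "irrefl R"
  have finJ: "finite J1" "finite J2" by (simp_all add: J1 J2)
  \<comment> \<open>The cap makes \<open>card (A k) + card S\<close> equal to
    \<open>f (Inl k)\<close> even when the subtraction truncates.\<close>
  obtain S where S: "S \<subseteq> J1" "card S = min (f (Inl k)) (card J1)"
    by (meson min.cobounded2 obtain_subset_with_card_n)
  have finS: "finite S" using S finJ finite_subset by blast
  \<comment> \<open>The colors \<open>M + j\<close> are fresh for \<open>A k\<close>.\<close>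
  obtain M where M: "k < a \<Longrightarrow> x \<in> A k \<Longrightarrow> x < M" for x
    by (metis A(1) finite_nat_set_iff_bounded)
  obtain g where g: "inj_on g R" "g ` R \<subseteq> J2"
    using card_le_inj[OF R(1) finJ(2) R(2)] by auto
  \<comment> \<open>Each pair of \<open>R\<close> is the list of its own vertex in
    \<open>J2\<close>; vertices left over get the dummy pair of colors 0 and 1.\<close>
  define e where "e j = (if j \<in> g ` R then inv_into R g j else (0, 1))" for j
  have e: "fst (e j) \<noteq> snd (e j)" for j
  proof (cases "j \<in> g ` R")
    case True
    then have "e j \<in> R" by (simp add: e_def inv_into_into)
    with R(3) show ?thesis by (metis irrefl_def prod.collapse)
  qed (simp add: e_def)
  have eg: "e (g r) = r" if "r \<in> R" for r
    using that g(1) by (simp add: e_def)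
  define L where "L = case_sum (\<lambda>i. if i = k then A i \<union> (\<lambda>j. M + j) ` S else A i)
    (\<lambda>j. if j \<in> J1 then {M + j} else if j \<in> J2 then {fst (e j), snd (e j)} else {..<f (Inr j)})"
  have Ak: "card (A k \<union> (\<lambda>j. M + j) ` S) = f (Inl k)" if "k < a"
  proof -
    have "card (A k \<union> (\<lambda>j. M + j) ` S) = card (A k) + card ((\<lambda>j. M + j) ` S)"
      by (rule card_Un_disjoint) (use A(1) that finS M in fastforce)+
    also have "card ((\<lambda>j. M + j) ` S) = card S" by (simp add: card_image)
    finally show ?thesis using A(2)[OF that] S(2) by simp
  qed
  have "f_assignment (complete_bipartite a q) f L"
    unfolding f_assignment_complete_bipartite
    using A finS Ak e by (auto simp: L_def J1 J2 card_insert_if)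
  then have "list_colorable (complete_bipartite a q) L"
    using ch by (auto simp: f_choosable_def)
  then obtain c where c: "\<And>i. i < a \<Longrightarrow> c i \<in> L (Inl i)" "\<And>j. j < q \<Longrightarrow> \<not> L (Inr j) \<subseteq> c ` {..<a}"
    unfolding list_colorable_complete_bipartite by blast
  \<comment> \<open>Each added color \<open>M + j\<close> is the whole list of a vertex on the
    \<open>q\<close>-side, so it cannot be used on the \<open>a\<close>-side.\<close>
  have "c i \<in> A i" if "i < a" for i
  proof (rule ccontr)
    assume "c i \<notin> A i"
    with c(1)[OF that] obtain j where j: "j \<in> S" "c i = M + j"
      by (auto simp: L_def split: if_splits)
    with S have "j < q" "L (Inr j) = {c i}" by (auto simp: J1 L_def)
    with c(2)[of j] that show False by auto
  qed
  moreover have "(c i, c j) \<notin> R" if "i < a" "j < a" for i j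
  proof
    assume r: "(c i, c j) \<in> R"
    let ?n = "g (c i, c j)"
    have n: "?n \<in> J2" using g(2) r by blast
    then have "L (Inr ?n) = {c i, c j}" using eg[OF r] by (auto simp: L_def J1 J2)
    with c(2)[of ?n] n that show False by (auto simp: J2)
  qed
  ultimately show "\<exists>c. (\<forall>i<a. c i \<in> A i) \<and> (\<forall>i<a. \<forall>j<a. (c i, c j) \<notin> R)" by blast
qed

lemma forcing_imp_pos: "forcing a f m \<Longrightarrow> i < a \<Longrightarrow> f i > 0"
proof (rule ccontr)
  assume F: "forcing a f m" and i: "i < a" "\<not> f i > 0"
  obtain c where "\<And>j. j < a \<Longrightarrow> c j \<in> {..<f j}"
    by (rule forcingE[OF F, of "\<lambda>j. {..<f j}" "{}"]) (auto simp: irrefl_def)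
  from this[OF i(1)] i(2) show False by simp
qed

text \<open>Here \<open>p\<close> is the number of lists of size 2 in an optimal size function. The
  inequalities are written additively to avoid truncated subtraction.\<close>

lemma forcing_number_le_sum_choice_number:
  assumes a: "a \<ge> 2"
  obtains p where "p \<le> q"
    "q + 2 * q \<le> p + sum_choice_number (complete_bipartite a q)"
    "forcing_number a p + 2 * q \<le> sum_choice_number (complete_bipartite a q)"
proof -
  have "pair_graph (complete_bipartite a q)"
    by unfold_locales (auto simp: complete_bipartite_def symmetric_def sym_def)
  then obtain f where ch: "f_choosable (complete_bipartite a q) f"
    and f: "(\<Sum>v\<in>pverts (complete_bipartite a q). f v) = sum_choice_number (complete_bipartite a q)"
    using sum_choice_number_attained by blast
  define J1 where "J1 = {j. j < q \<and> f (Inr j) = 1}"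
  define J2 where "J2 = {j. j < q \<and> f (Inr j) = 2}"
  let ?f = "\<lambda>k. (\<lambda>i. f (Inl i))(k := f (Inl k) - card J1)"
  note F = forcing_if_f_choosable[OF ch J1_def J2_def]
  \<comment> \<open>The vertex \<open>k\<close> in \<open>F\<close> is arbitrary, so every list on
    the \<open>a\<close>-side is larger than the number of singletons.\<close>
  have gt: "card J1 < f (Inl k)" if "k < a" for k
    using forcing_imp_pos[OF F[of k] that] by simp
  have card2: "card J2 \<le> q"
    unfolding J2_def by (metis (no_types, lifting) card_lessThan card_mono finite_lessThan lessThan_iff mem_Collect_eq subsetI)
  have upd: "(\<Sum>i<a. ?f 0 i) + card J1 = (\<Sum>i<a. f (Inl i))"
  proof -
    have "(\<Sum>i<a. ?f 0 i) = ?f 0 0 + (\<Sum>i\<in>{..<a}-{0}. ?f 0 i)"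
      by (rule sum.remove) (use a in auto)
    moreover have "(\<Sum>i<a. f (Inl i)) = f (Inl 0) + (\<Sum>i\<in>{..<a}-{0}. f (Inl i))"
      by (rule sum.remove) (use a in auto)
    moreover have "(\<Sum>i\<in>{..<a}-{0}. ?f 0 i) = (\<Sum>i\<in>{..<a}-{0}. f (Inl i))"
      by (rule sum.cong) auto
    ultimately show ?thesis using gt[of 0] a by simp
  qed
  \<comment> \<open>Compared with size 3, a list of size 1 lacks two colors and a list of size 2
    lacks one.\<close>
  have "(\<Sum>j<q. 3) \<le> (\<Sum>j<q. f (Inr j) + (of_bool (j \<in> J1) + of_bool (j \<in> J1)) + of_bool (j \<in> J2))"
  proof (rule sum_mono)
    fix j assume "j \<in> {..<q}"
    then show "3 \<le> f (Inr j) + (of_bool (j \<in> J1) + of_bool (j \<in> J1)) + of_bool (j \<in> J2)"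
      using f_choosable_pos[OF ch, of j] by (auto simp: J1_def J2_def)
  qed
  moreover have "(\<Sum>j<q. of_bool (j \<in> J1)) = card J1" "(\<Sum>j<q. of_bool (j \<in> J2)) = card J2"
    by (auto simp: J1_def J2_def sum.If_cases of_bool_def Int_def intro!: arg_cong[of _ _ card])
  ultimately have three: "3 * q \<le> (\<Sum>j<q. f (Inr j)) + 2 * card J1 + card J2"
    by (simp add: sum.distrib)
  \<comment> \<open>Compared with size 2, only singletons fall short, by one each; lowering vertex 0
    by \<open>card J1\<close> compensates for this.\<close>
  have "(\<Sum>j<q. 2) \<le> (\<Sum>j<q. f (Inr j) + of_bool (j \<in> J1))"
  proof (rule sum_mono)
    fix j assume "j \<in> {..<q}"
    then show "2 \<le> f (Inr j) + of_bool (j \<in> J1)"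
      using f_choosable_pos[OF ch, of j] by (auto simp: J1_def)
  qed
  then have two: "2 * q \<le> (\<Sum>j<q. f (Inr j)) + card J1"
    using \<open>(\<Sum>j<q. of_bool (j \<in> J1)) = card J1\<close> by (simp add: sum.distrib)
  \<comment> \<open>Since \<open>a \<ge> 2\<close>, two vertices of the \<open>a\<close>-side supply
    the term \<open>2 * card J1\<close> of \<open>three\<close>.\<close>
  have "(\<Sum>i\<in>{0, 1}. f (Inl i)) \<le> (\<Sum>i<a. f (Inl i))"
    by (rule sum_mono2) (use a in auto)
  then have "2 * card J1 \<le> (\<Sum>i<a. f (Inl i))"
    using gt[of 0] gt[of 1] a by simp
  with three card2 have "q + 2 * q \<le> card J2 + sum_choice_number (complete_bipartite a q)"
    unfolding f[symmetric] sum_complete_bipartite by simp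
  moreover have "forcing_number a (card J2) + 2 * q \<le> sum_choice_number (complete_bipartite a q)"
    using forcing_number_le[OF F[of 0]] upd two
    unfolding f[symmetric] sum_complete_bipartite by simp
  ultimately show ?thesis using that card2 by blast
qed

section \<open>Squeezing the normalized sum choice number\<close>

theorem theorem5p1:
  fixes a :: nat
  assumes "a \<ge> 2"
  shows "\<exists>l :: real.
    (\<lambda>q :: nat. (real (sum_choice_number (complete_bipartite a q)) - 2 * real q) / sqrt (real q))
      \<longlonglongrightarrow> l"
proof -
  define F where "F = forcing_number a"
  define x where "x q = real (sum_choice_number (complete_bipartite a q)) - 2 * real q" for q
  define C :: real where "C = a * (4 * (a + 1) + 1)"
  have FC: "F m \<le> C * sqrt m" if "m > 0" for m
    using forcing_number_le_sqrt[OF that, of a] by (simp add: F_def C_def)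
  have "\<exists>l. (\<lambda>q. F q / sqrt q) \<longlonglongrightarrow> l"
    unfolding F_def
    using forcing_number_mono forcing_number_scale FC[unfolded F_def]
    by (rule sqrt_quotient_limit[where b = "real a"]) simp_all
  then obtain l where l: "(\<lambda>q. F q / sqrt q) \<longlonglongrightarrow> l" by blast
  have xF: "x q \<le> F q" for q
    using sum_choice_number_le[of a q] by (simp add: x_def F_def)
  have "\<exists>p \<le> q. real q - x q \<le> p \<and> F p \<le> x q" for q
    by (rule forcing_number_le_sum_choice_number[OF assms, of q])
      (force simp: x_def F_def)
  then obtain p where p: "\<And>q. p q \<le> q" "\<And>q. real q - x q \<le> p q" "\<And>q. F (p q) \<le> x q"
    by metis
  have sqrt_inf: "filterlim (\<lambda>q. sqrt (real q)) at_top sequentially"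
    by (intro filterlim_compose[OF sqrt_at_top] filterlim_real_sequentially)
  have "(\<lambda>q. C / sqrt (real q)) \<longlonglongrightarrow> 0"
    using sqrt_inf by (rule real_tendsto_divide_at_top[OF tendsto_const])
  from tendsto_diff[OF tendsto_const[of 1] this]
  have lim1: "(\<lambda>q. 1 - C / sqrt (real q)) \<longlonglongrightarrow> 1" by simp
  \<comment> \<open>For \<open>q > 0\<close>,
    \<open>q - C * sqrt q \<le> q - x q \<le> p q \<le> q\<close>.\<close>
  have ratio: "(\<lambda>q. real (p q) / real q) \<longlonglongrightarrow> 1"
  proof (rule tendsto_sandwich[OF _ _ lim1 tendsto_const])
    show "\<forall>\<^sub>F q in sequentially. 1 - C / sqrt (real q) \<le> real (p q) / real q"
      using eventually_gt_at_top[of 0]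
    proof eventually_elim
      case (elim q)
      have "real q - C * sqrt q \<le> p q" using p(2)[of q] xF[of q] FC[OF elim] by linarith
      then have "(real q - C * sqrt q) / q \<le> p q / q" by (rule divide_right_mono) simp
      moreover have "C * sqrt q / q = C / sqrt q"
        using elim by (simp add: field_simps)
      ultimately show ?case using elim by (simp add: diff_divide_distrib)
    qed
    show "\<forall>\<^sub>F q in sequentially. real (p q) / real q \<le> 1"
      using p(1) by (intro always_eventually allI) (simp add: divide_le_eq)
  qed
  have "filterlim (\<lambda>q. real (p q) / real q * real q) at_top sequentially"
    by (rule filterlim_tendsto_pos_mult_at_top[OF ratio _ filterlim_real_sequentially]) simp
  moreover have "\<forall>\<^sub>F q in sequentially. real (p q) / real q * real q = real (p q)"
    using eventually_gt_at_top[of 0] by eventually_elim simp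
  ultimately have "filterlim (\<lambda>q. real (p q)) at_top sequentially"
    by (simp cong: filterlim_cong)
  then have p_inf: "filterlim p at_top sequentially"
    by (simp add: filterlim_sequentially_iff_filterlim_real)
  \<comment> \<open>As \<open>p q\<close> tends to infinity, the limit \<open>l\<close> holds along
    \<open>p q\<close> too; \<open>ratio\<close> then changes the denominator to
    \<open>sqrt q\<close>.\<close>
  have "(\<lambda>q. F (p q) / sqrt (p q) * sqrt (p q / q)) \<longlonglongrightarrow> l * sqrt 1"
    by (intro tendsto_mult tendsto_real_sqrt ratio filterlim_compose[OF l p_inf])
  then have lower: "(\<lambda>q. F (p q) / sqrt (p q) * sqrt (p q / q)) \<longlonglongrightarrow> l" by simp
  have "(\<lambda>q. x q / sqrt q) \<longlonglongrightarrow> l"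
  proof (rule tendsto_sandwich[OF _ _ lower l])
    show "\<forall>\<^sub>F q in sequentially. x q / sqrt q \<le> F q / sqrt q"
      using xF by (intro always_eventually allI divide_right_mono) auto
    have "\<forall>\<^sub>F q in sequentially. p q > 0"
      by (rule eventually_compose_filterlim[OF eventually_gt_at_top p_inf])
    then show "\<forall>\<^sub>F q in sequentially. F (p q) / sqrt (p q) * sqrt (p q / q) \<le> x q / sqrt q"
    proof eventually_elim
      case (elim q)
      then have "F (p q) / sqrt (p q) * sqrt (p q / q) = F (p q) / sqrt q"
        by (simp add: real_sqrt_divide)
      also have "\<dots> \<le> x q / sqrt q"
        using p(3)[of q] by (intro divide_right_mono) auto
      finally show ?case .
    qed
  qed
  then show ?thesis unfolding x_def by blast
qed

end
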